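(* Consider the KL-penalized unbalanced optimal transport (UOT) problem and let $\hat{\boldsymbol\theta}=[\hat{\boldsymbol\alpha}^T,\hat{\boldsymbol\beta}^T]^T$, $\hat{\boldsymbol\alpha}\in\mathbb{R}^m$, $\hat{\boldsymbol\beta}\in\mathbb{R}^n$, be its optimal dual solution. Let $\boldsymbol\theta\in\mathbb{R}^{m+n}$ be any vector and $\boldsymbol t\in\mathbb{R}^{nm}_+$ a primal variable. For each $j\in\{0,\dots,m+n-1\}$ put $K^j=\mathbf D(\boldsymbol\theta)-\mathbf P^j(\boldsymbol t)$ and $$\operatorname{Low}(\boldsymbol\theta,j)=\ln\left(\frac{\epsilon-y_j}{K^j-y_j+\epsilon}\right).$$ Then $\operatorname{Low}(\boldsymbol\theta,j)$ is a lower bound of $\hat\theta_j$. Moreover, writing $\underline{\beta_v}=\operatorname{Low}(\boldsymbol\theta,m+v)$ for the resulting lower bound of $\hat\beta_v$, for every $0\le u<m$ there is an upper bound $\overline{\alpha_u}$ of $\hat\alpha_u$ with $$\hat\alpha_u<\overline{\alpha_u}<\min_{0\le v<n}\bigl(\lambda c_{un+v}-\underline{\beta_v}\bigr).$$ By the symmetry of rows and columns, the same holds for $\hat\beta_v$, $0\le v<n$, with $\underline{\alpha_u}=\operatorname{Low}(\boldsymbol\theta,u)$: there is an upper bound $\overline{\beta_v}$ with $\hat\beta_v<\overline{\beta_v}<\min_{0\le u<m}(\lambda c_{un+v}-\underline{\alpha_u})$.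
   Context: Let $m,n\ge1$, a weight $\lambda>0$, a cost vector $\boldsymbol c\in\mathbb{R}^{nm}_+$, a vector $\boldsymbol y\in\mathbb{R}^{m+n}$ with positive entries (the concatenation of the two given discrete measures), and the constant $\epsilon$ appearing in the KL penalty be given. Indices start at $0$. A transport matrix $\mathbf T$ with $m$ rows and $n$ columns and nonnegative entries is flattened row by row into $\boldsymbol t\in\mathbb{R}^{nm}_+$ ($t_{un+v}=T_{u,v}$), and the cost matrix into $\boldsymbol c$ likewise. The index matrix $\mathbf X\in\{0,1\}^{(m+n)\times nm}$ is such that $\mathbf X\boldsymbol t$ lists the $m$ row sums followed by the $n$ column sums of $\mathbf T$; its $p$-th column $\boldsymbol x_p$, $p=un+v$, has exactly two entries equal to $1$, at positions $u$ and $m+v$. The KL-penalized UOT problem is to minimize over $\boldsymbol t\in\mathbb{R}^{nm}_+$ $$\mathbf P(\boldsymbol t)=\lambda\boldsymbol c^T\boldsymbol t+\sum_{i=0}^{m+n-1}\left[((\mathbf X\boldsymbol t)_i+\epsilon)\ln\frac{(\mathbf X\boldsymbol t)_i+\epsilon}{y_i}-((\mathbf X\boldsymbol t)_i+\epsilon)+y_i\right].$$ Its dual is to maximize $\mathbf D(\boldsymbol\theta)=\sum_{i=0}^{m+n-1}\mathbf D^i(\theta_i)$, where $\mathbf D^i(\theta_i)=-y_ie^{-\theta_i}+y_i-\epsilon\theta_i$ is the part of the dual objective in the $i$-th coordinate, subject to $\boldsymbol x_p^T\boldsymbol\theta-\lambda c_p\le0$ for all $0\le p<nm$; the maximizer is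 $\hat{\boldsymbol\theta}$. For each $j$, $\mathbf P^j$ is the primal problem of $\sum_{i\ne j}\mathbf D^i(\theta_i)$, i.e. the UOT problem obtained by deleting $y_j$, the $j$-th row of $\mathbf X$, and all variables $t_p$ (with their costs $c_p$ and columns $\boldsymbol x_p$) for which $X_{j,p}=1$. Explicitly, with $S_j=\{p:X_{j,p}=0\}$ and $z_i=\sum_{p\in S_j}X_{i,p}t_p$, $$\mathbf P^j(\boldsymbol t)=\lambda\sum_{p\in S_j}c_pt_p+\sum_{i\ne j}\left[(z_i+\epsilon)\ln\frac{z_i+\epsilon}{y_i}-(z_i+\epsilon)+y_i\right].$$
   Formalization: The formal theorem requires θ to be dual feasible (not any vector), ε ≥ 0, and ε < y_j for the indices j whose Low is used; for infeasible θ or ε > y_j the claimed lower bound can fail, and for ε = y_j Low is undefined. *)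

theory Defs
  imports Complex_Main "Jordan_Normal_Form.Matrix"
begin

text \<open>
  Vectors and matrices are those of \<open>Jordan_Normal_Form.Matrix\<close>, indexed from 0. A transport
  matrix with \<open>m\<close> rows and \<open>n\<close> columns is flattened row by row: entry \<open>(u, v)\<close> sits at
  position \<open>p = u * n + v\<close>, so \<open>u = p div n\<close> and \<open>v = p mod n\<close>.
\<close>

definition index_mat :: "nat \<Rightarrow> nat \<Rightarrow> real mat" where
  "index_mat m n =
     mat (m + n) (n * m) (\<lambda>(i, p). if i = p div n \<or> i = m + p mod n then 1 else 0)"

lemma index_mat_col:
  assumes "u < m" "v < n" "i < m + n"
  shows "col (index_mat m n) (u * n + v) $ i = (if i = u \<or> i = m + v then 1 else 0)"
proof -
  have "u * n + v < Suc u * n"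
    using assms by simp
  also have "\<dots> \<le> n * m"
    using assms by (metis Suc_leI mult.commute mult_le_mono1)
  finally show ?thesis
    using assms by (simp add: index_mat_def)
qed

definition dual_part :: "real \<Rightarrow> real vec \<Rightarrow> nat \<Rightarrow> real \<Rightarrow> real" where
  "dual_part \<epsilon> y i s = - (y $ i) * exp (- s) + y $ i - \<epsilon> * s"

definition dual_obj :: "nat \<Rightarrow> nat \<Rightarrow> real \<Rightarrow> real vec \<Rightarrow> real vec \<Rightarrow> real" where
  "dual_obj m n \<epsilon> y \<theta> = (\<Sum>i<m + n. dual_part \<epsilon> y i (\<theta> $ i))"

definition dual_feasible :: "nat \<Rightarrow> nat \<Rightarrow> real \<Rightarrow> real vec \<Rightarrow> real vec \<Rightarrow> bool" where
  "dual_feasible m n lam c \<theta> \<longleftrightarrow>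
     \<theta> \<in> carrier_vec (m + n) \<and>
     (\<forall>p<n * m. col (index_mat m n) p \<bullet> \<theta> - lam * c $ p \<le> 0)"

definition dual_optimal ::
    "nat \<Rightarrow> nat \<Rightarrow> real \<Rightarrow> real \<Rightarrow> real vec \<Rightarrow> real vec \<Rightarrow> real vec \<Rightarrow> bool" where
  "dual_optimal m n lam \<epsilon> c y \<theta> \<longleftrightarrow>
     is_arg_max (dual_obj m n \<epsilon> y) (dual_feasible m n lam c) \<theta>"

text \<open>For \<open>\<epsilon> = 0\<close> and \<open>z = 0\<close> the next term is \<open>b\<close>, i.e. the usual convention \<open>0 ln 0 = 0\<close>.\<close>

definition kl_term :: "real \<Rightarrow> real \<Rightarrow> real \<Rightarrow> real" where
  "kl_term \<epsilon> b z = (z + \<epsilon>) * ln ((z + \<epsilon>) / b) - (z + \<epsilon>) + b"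

definition primal_obj ::
    "nat \<Rightarrow> nat \<Rightarrow> real \<Rightarrow> real \<Rightarrow> real vec \<Rightarrow> real vec \<Rightarrow> real vec \<Rightarrow> real" where
  "primal_obj m n lam \<epsilon> c y t =
     lam * (c \<bullet> t) + (\<Sum>i<m + n. kl_term \<epsilon> (y $ i) ((index_mat m n *\<^sub>v t) $ i))"

definition kept_vars :: "nat \<Rightarrow> nat \<Rightarrow> nat \<Rightarrow> nat set" where
  "kept_vars m n j = {p. p < n * m \<and> index_mat m n $$ (j, p) = 0}"

text \<open>
  The primal objective after deleting coordinate \<open>j\<close>. Its argument is still the full vector \<open>t\<close>,
  of which only the entries in \<open>kept_vars m n j\<close> are read.
\<close>

definition primal_obj_del ::
    "nat \<Rightarrow> nat \<Rightarrow> real \<Rightarrow> real \<Rightarrow> real vec \<Rightarrow> real vec \<Rightarrow> nat \<Rightarrow> real vec \<Rightarrow> real" where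
  "primal_obj_del m n lam \<epsilon> c y j t =
     lam * (\<Sum>p\<in>kept_vars m n j. c $ p * t $ p) +
     (\<Sum>i\<in>{..<m + n} - {j}.
        kl_term \<epsilon> (y $ i) (\<Sum>p\<in>kept_vars m n j. index_mat m n $$ (i, p) * t $ p))"

definition gap ::
    "nat \<Rightarrow> nat \<Rightarrow> real \<Rightarrow> real \<Rightarrow> real vec \<Rightarrow> real vec \<Rightarrow> real vec \<Rightarrow> real vec \<Rightarrow> nat \<Rightarrow> real" where
  "gap m n lam \<epsilon> c y t \<theta> j = dual_obj m n \<epsilon> y \<theta> - primal_obj_del m n lam \<epsilon> c y j t"

definition Low ::
    "nat \<Rightarrow> nat \<Rightarrow> real \<Rightarrow> real \<Rightarrow> real vec \<Rightarrow> real vec \<Rightarrow> real vec \<Rightarrow> real vec \<Rightarrow> nat \<Rightarrow> real" where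
  "Low m n lam \<epsilon> c y t \<theta> j =
     ln ((\<epsilon> - y $ j) / (gap m n lam \<epsilon> c y t \<theta> j - y $ j + \<epsilon>))"

end

theory Submission
  imports Defs
begin

text \<open>
  Why the theorem holds. Fix a coordinate \<open>j\<close>. Deleting it leaves a smaller transport problem, for
  which the remaining entries of the dual optimum \<open>\<theta>hat\<close> are still feasible. Weak duality
  (\<open>weak_duality_del\<close>) bounds their contribution by the deleted primal objective, while optimality
  gives \<open>D(\<theta>) \<le> D(\<theta>hat)\<close>; so the gap \<open>K\<close> satisfies
  \<open>K \<le> - y\<^sub>j exp (- \<theta>hat\<^sub>j) + y\<^sub>j - \<epsilon> \<theta>hat\<^sub>j\<close>. Estimating the linear term by
  \<open>- s \<le> exp (- s) - 1\<close> leaves an inequality in \<open>exp (- \<theta>hat\<^sub>j)\<close> alone, and solving it yields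
  \<open>Low\<close>; the division keeps the right direction because \<open>\<epsilon> - y\<^sub>j < 0\<close>.

  Inserting this bound into the dual constraint \<open>\<alpha>\<^sub>u + \<beta>\<^sub>v \<le> lam * c\<close> gives an upper bound for
  \<open>\<alpha>\<^sub>u\<close>. There is room for a number strictly between only if \<open>\<alpha>\<^sub>u\<close> is strictly below it,
  and the constraint may well be active, so the lower bound itself has to be strict. It is:
  if all estimates above were equalities, then weak duality would determine the marginals of the
  deleted plan as \<open>y\<^sub>i exp (- \<theta>hat\<^sub>i) - \<epsilon>\<close> for \<open>i \<noteq> j\<close>. Row and column marginals of a plan have the
  same total. The numbers \<open>y\<^sub>i exp (- \<theta>hat\<^sub>i) - \<epsilon>\<close>, with \<open>j\<close> included, are balanced in the same
  way, since the dual constraints allow raising all row potentials and lowering all column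
  potentials by a common amount (\<open>dual_optimal_balanced\<close>). Hence \<open>y\<^sub>j exp (- \<theta>hat\<^sub>j) = \<epsilon>\<close>.
  Then \<open>\<epsilon> > 0\<close>, and \<open>\<epsilon> < y\<^sub>j\<close> forces \<open>\<theta>hat\<^sub>j \<noteq> 0\<close>, so \<open>- s \<le> exp (- s) - 1\<close> was strict
  after all (\<open>Low_less\<close>).
\<close>

section \<open>The index matrix and dual feasibility\<close>

lemma index_mat_entry:
  assumes "i < m + n" "p < n * m"
  shows "index_mat m n $$ (i, p) = (if i = p div n \<or> i = m + p mod n then 1 else 0)"
  using assms by (simp add: index_mat_def)

lemma index_mat_nonneg:
  assumes "i < m + n" "p < n * m"
  shows "0 \<le> index_mat m n $$ (i, p)"
  using assms by (simp add: index_mat_entry)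

lemma sum_index_mat:
  assumes p: "p < n * m"
  shows "(\<Sum>i<m + n. index_mat m n $$ (i, p) * f i) = f (p div n) + f (m + p mod n)"
proof -
  have n: "0 < n" using p by (cases n) auto
  have u: "p div n < m" using p by (metis less_mult_imp_div_less mult.commute)
  have v: "m + p mod n < m + n" using n by simp
  have "(\<Sum>i<m + n. index_mat m n $$ (i, p) * f i)
      = (\<Sum>i<m + n. (if i = p div n then f i else 0) + (if i = m + p mod n then f i else 0))"
    using p u by (intro sum.cong) (auto simp: index_mat_entry)
  also have "\<dots> = f (p div n) + f (m + p mod n)"
    using u v by (simp add: sum.distrib)
  finally show ?thesis .
qed

lemma scalar_prod_col_index_mat:
  assumes "\<theta> \<in> carrier_vec (m + n)" "p < n * m"
  shows "col (index_mat m n) p \<bullet> \<theta> = (\<Sum>i<m + n. index_mat m n $$ (i, p) * \<theta> $ i)"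
  using assms by (auto simp: scalar_prod_def index_mat_def lessThan_atLeast0 intro!: sum.cong)

lemma dual_feasible_iff:
  "dual_feasible m n lam c \<theta> \<longleftrightarrow> \<theta> \<in> carrier_vec (m + n) \<and>
     (\<forall>p<n * m. \<theta> $ (p div n) + \<theta> $ (m + p mod n) \<le> lam * c $ p)"
  by (auto simp: dual_feasible_def scalar_prod_col_index_mat sum_index_mat)

section \<open>Weak duality after deleting a coordinate\<close>

text \<open>
  This is the Fenchel--Young inequality of the Kullback--Leibler penalty. With \<open>w = z + \<epsilon>\<close> and
  \<open>r = b * exp (- s) / w\<close> it is \<open>ln r \<le> r - 1\<close> scaled by \<open>w\<close>, which is an equality only at \<open>r = 1\<close>.
\<close>

lemma kl_term_fenchel:
  assumes b: "0 < b" and w: "0 \<le> z + \<epsilon>"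
  shows "- b * exp (- s) + b - \<epsilon> * s \<le> kl_term \<epsilon> b z + s * z"
    and "- b * exp (- s) + b - \<epsilon> * s = kl_term \<epsilon> b z + s * z \<Longrightarrow> z + \<epsilon> = b * exp (- s)"
proof -
  define w where "w = z + \<epsilon>"
  have z: "z = w - \<epsilon>" by (simp add: w_def)
  have "- b * exp (- s) + b - \<epsilon> * s \<le> kl_term \<epsilon> b z + s * z \<and>
      (- b * exp (- s) + b - \<epsilon> * s = kl_term \<epsilon> b z + s * z \<longrightarrow> w = b * exp (- s))"
  proof (cases "w = 0")
    case True
    have "0 < b * exp (- s)" using b by simp
    then show ?thesis using True by (simp add: kl_term_def z algebra_simps)
  next
    case False
    then have w0: "0 < w" using w by (simp add: w_def)
    define r where "r = b * exp (- s) / w"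
    have r0: "0 < r" using b w0 by (simp add: r_def)
    have "ln r = ln b - s - ln w"
      using b w0 by (simp add: r_def ln_div ln_mult)
    then have ln_w: "ln (w / b) = - s - ln r" using b w0 by (simp add: ln_div)
    have br: "b * exp (- s) = w * r" using w0 by (simp add: r_def)
    have diff: "kl_term \<epsilon> b z + s * z - (- b * exp (- s) + b - \<epsilon> * s) = w * (r - 1 - ln r)"
      by (simp add: kl_term_def z ln_w br algebra_simps)
    have le: "0 \<le> w * (r - 1 - ln r)"
      using w0 ln_le_minus_one[OF r0] by simp
    have eq: "w = b * exp (- s)" if "w * (r - 1 - ln r) = 0"
    proof -
      have "ln r = r - 1" using that w0 by simp
      then have "r = 1" using ln_eq_minus_one[OF r0] by simp
      then show ?thesis using br by simp
    qed
    show ?thesis using diff le eq by auto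
  qed
  then show "- b * exp (- s) + b - \<epsilon> * s \<le> kl_term \<epsilon> b z + s * z"
    and "- b * exp (- s) + b - \<epsilon> * s = kl_term \<epsilon> b z + s * z \<Longrightarrow> z + \<epsilon> = b * exp (- s)"
    by (simp_all add: w_def)
qed

definition marginal_del :: "nat \<Rightarrow> nat \<Rightarrow> nat \<Rightarrow> real vec \<Rightarrow> nat \<Rightarrow> real" where
  "marginal_del m n j t i = (\<Sum>p\<in>kept_vars m n j. index_mat m n $$ (i, p) * t $ p)"

lemma marginal_del_nonneg:
  assumes "i < m + n" "\<forall>p<n * m. t $ p \<ge> 0"
  shows "0 \<le> marginal_del m n j t i"
  unfolding marginal_del_def
  using assms by (intro sum_nonneg mult_nonneg_nonneg index_mat_nonneg) (auto simp: kept_vars_def)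

text \<open>
  Double counting over the plan: each kept variable contributes at its row and at its column, and
  never at \<open>j\<close>, so leaving out \<open>i = j\<close> changes nothing.
\<close>

lemma sum_marginal_del:
  assumes j: "j < m + n"
  shows "(\<Sum>i\<in>{..<m + n} - {j}. f i * marginal_del m n j t i)
       = (\<Sum>p\<in>kept_vars m n j. (f (p div n) + f (m + p mod n)) * t $ p)"
proof -
  have "marginal_del m n j t j = 0"
    by (simp add: marginal_del_def kept_vars_def)
  then have "(\<Sum>i\<in>{..<m + n} - {j}. f i * marginal_del m n j t i)
      = (\<Sum>i<m + n. f i * marginal_del m n j t i)"
    using j by (simp add: sum_diff1)
  also have "\<dots> = (\<Sum>p\<in>kept_vars m n j. \<Sum>i<m + n. index_mat m n $$ (i, p) * f i * t $ p)"
    by (simp add: marginal_del_def sum_distrib_left mult_ac sum.swap[of _ _ "{..<m + n}"])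
  also have "\<dots> = (\<Sum>p\<in>kept_vars m n j. (f (p div n) + f (m + p mod n)) * t $ p)"
    by (intro sum.cong)
      (auto simp: kept_vars_def sum_index_mat[symmetric] sum_distrib_right)
  finally show ?thesis .
qed

text \<open>
  Summing the Fenchel--Young inequality over the remaining coordinates leaves the coupling of
  \<open>\<theta>\<close> with the marginals, which the constraints bound by the transport cost. Equality in the sum
  forces equality in every summand, which fixes the marginals.
\<close>

lemma weak_duality_del:
  assumes \<epsilon>: "0 \<le> \<epsilon>" and y: "\<forall>i<m + n. y $ i > 0" and t: "\<forall>p<n * m. t $ p \<ge> 0"
    and feas: "dual_feasible m n lam c \<theta>" and j: "j < m + n"
  shows "(\<Sum>i\<in>{..<m + n} - {j}. dual_part \<epsilon> y i (\<theta> $ i)) \<le> primal_obj_del m n lam \<epsilon> c y j t"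
    and "(\<Sum>i\<in>{..<m + n} - {j}. dual_part \<epsilon> y i (\<theta> $ i)) = primal_obj_del m n lam \<epsilon> c y j t \<Longrightarrow>
      i < m + n \<Longrightarrow> i \<noteq> j \<Longrightarrow> marginal_del m n j t i + \<epsilon> = y $ i * exp (- (\<theta> $ i))"
proof -
  let ?I = "{..<m + n} - {j}"
  let ?z = "marginal_del m n j t"
  define D where "D i = dual_part \<epsilon> y i (\<theta> $ i)" for i
  define F where "F i = kl_term \<epsilon> (y $ i) (?z i) + \<theta> $ i * ?z i" for i
  have z: "0 \<le> ?z i + \<epsilon>" if "i \<in> ?I" for i
    using that \<epsilon> marginal_del_nonneg[OF _ t, of i j] by simp
  have D_le: "D i \<le> F i" if "i \<in> ?I" for i
    unfolding D_def F_def dual_part_def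
    using that y z by (intro kl_term_fenchel(1)) auto
  have "(\<Sum>i\<in>?I. \<theta> $ i * ?z i) \<le> (\<Sum>p\<in>kept_vars m n j. lam * c $ p * t $ p)"
    unfolding sum_marginal_del[OF j]
    using feas t by (intro sum_mono mult_right_mono) (auto simp: dual_feasible_iff kept_vars_def)
  then have F_le: "sum F ?I \<le> primal_obj_del m n lam \<epsilon> c y j t"
    by (simp add: F_def primal_obj_del_def marginal_del_def sum.distrib sum_distrib_left mult_ac)
  show "(\<Sum>i\<in>?I. dual_part \<epsilon> y i (\<theta> $ i)) \<le> primal_obj_del m n lam \<epsilon> c y j t"
    using sum_mono[of ?I D F] D_le F_le by (simp add: D_def)
  assume eq: "(\<Sum>i\<in>?I. dual_part \<epsilon> y i (\<theta> $ i)) = primal_obj_del m n lam \<epsilon> c y j t"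
    and i: "i < m + n" "i \<noteq> j"
  have "sum F ?I \<le> sum D ?I" using eq F_le by (simp add: D_def)
  then have "(\<Sum>i\<in>?I. F i - D i) = 0"
    using sum_mono[of ?I D F] D_le by (simp add: sum_subtractf)
  then have "\<forall>i\<in>?I. F i - D i = 0"
    using D_le by (subst (asm) sum_nonneg_eq_0_iff) auto
  then have "D i = F i" using i by auto
  then show "?z i + \<epsilon> = y $ i * exp (- (\<theta> $ i))"
    unfolding D_def F_def dual_part_def
    using i y z by (intro kl_term_fenchel(2)) auto
qed

section \<open>Balance of the dual optimum\<close>

text \<open>\<open>side m\<close> is the direction along which all dual constraints stay constant.\<close>

definition side :: "nat \<Rightarrow> nat \<Rightarrow> real" where
  "side m i = (if i < m then 1 else - 1)"

lemma side_row_plus_col: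
  assumes "p < n * m"
  shows "side m (p div n) + side m (m + p mod n) = 0"
  using less_mult_imp_div_less[of p m n] assms by (simp add: side_def mult.commute)

text \<open>
  Moving the optimum along \<open>side m\<close> keeps it feasible in both directions, so the dual objective
  has vanishing directional derivative there.
\<close>

lemma dual_optimal_balanced:
  assumes opt: "dual_optimal m n lam \<epsilon> c y \<theta>"
  shows "(\<Sum>i<m + n. side m i * (y $ i * exp (- (\<theta> $ i)) - \<epsilon>)) = 0"
proof -
  have feas: "dual_feasible m n lam c \<theta>"
    and max: "\<And>\<eta>. dual_feasible m n lam c \<eta> \<Longrightarrow> dual_obj m n \<epsilon> y \<eta> \<le> dual_obj m n \<epsilon> y \<theta>"
    using opt by (auto simp: dual_optimal_def is_arg_max_linorder)
  define g where "g d = (\<Sum>i<m + n. dual_part \<epsilon> y i (\<theta> $ i + d * side m i))" for d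
  have "g d \<le> g 0" for d
  proof -
    define \<eta> where "\<eta> = vec (m + n) (\<lambda>i. \<theta> $ i + d * side m i)"
    have "dual_feasible m n lam c \<eta>"
      unfolding dual_feasible_iff
    proof (intro conjI allI impI)
      show "\<eta> \<in> carrier_vec (m + n)" by (simp add: \<eta>_def)
      fix p assume p: "p < n * m"
      then have n: "0 < n" by (cases n) auto
      have "p div n < m + n" "m + p mod n < m + n"
        using p n less_mult_imp_div_less[of p m n] by (simp_all add: mult.commute)
      then have "\<eta> $ (p div n) + \<eta> $ (m + p mod n)
          = \<theta> $ (p div n) + \<theta> $ (m + p mod n) + d * (side m (p div n) + side m (m + p mod n))"
        by (simp add: \<eta>_def algebra_simps)
      then show "\<eta> $ (p div n) + \<eta> $ (m + p mod n) \<le> lam * c $ p"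
        using feas p by (simp add: side_row_plus_col dual_feasible_iff)
    qed
    from max[OF this] show ?thesis
      by (simp add: g_def dual_obj_def \<eta>_def)
  qed
  moreover have "(g has_real_derivative
      (\<Sum>i<m + n. side m i * (y $ i * exp (- (\<theta> $ i)) - \<epsilon>))) (at 0)"
    unfolding g_def dual_part_def
    by (auto intro!: derivative_eq_intros sum.cong simp: algebra_simps)
  ultimately show ?thesis
    using DERIV_local_max[of g _ 0 1] by auto
qed

section \<open>The strict lower bound and its consequences\<close>

text \<open>
  The right-hand side is the dual part at \<open>\<theta>hat\<^sub>j\<close> after \<open>- s \<le> exp (- s) - 1\<close>, which makes it
  solvable for \<open>\<theta>hat\<^sub>j\<close>. Strictness has two sources: if \<open>y\<^sub>j exp (- \<theta>hat\<^sub>j) = \<epsilon>\<close>, then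
  \<open>\<theta>hat\<^sub>j \<noteq> 0\<close> and \<open>\<epsilon> > 0\<close>, so this tangent estimate loses something;
  otherwise the masses prescribed by equality in weak duality cannot be balanced without \<open>j\<close>.
\<close>

lemma gap_less:
  assumes \<epsilon>: "0 \<le> \<epsilon>" and y: "\<forall>i<m + n. y $ i > 0" and t: "\<forall>p<n * m. t $ p \<ge> 0"
    and opt: "dual_optimal m n lam \<epsilon> c y \<theta>hat" and feas: "dual_feasible m n lam c \<theta>"
    and j: "j < m + n" and less: "\<epsilon> < y $ j"
  shows "gap m n lam \<epsilon> c y t \<theta> j < (\<epsilon> - y $ j) * exp (- (\<theta>hat $ j)) + y $ j - \<epsilon>"
proof -
  let ?I = "{..<m + n} - {j}"
  define s where "s = \<theta>hat $ j"
  have feas_hat: "dual_feasible m n lam c \<theta>hat"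
    and max: "dual_obj m n \<epsilon> y \<theta> \<le> dual_obj m n \<epsilon> y \<theta>hat"
    using opt feas by (auto simp: dual_optimal_def is_arg_max_linorder)
  have sum_split: "(\<Sum>i<m + n. f i) = f j + sum f ?I" for f :: "nat \<Rightarrow> real"
    using j by (simp add: sum.remove)
  let ?D = "\<Sum>i\<in>?I. dual_part \<epsilon> y i (\<theta>hat $ i)"
  let ?P = "primal_obj_del m n lam \<epsilon> c y j t"
  note weak = weak_duality_del[OF \<epsilon> y t feas_hat j]
  have gap_le: "gap m n lam \<epsilon> c y t \<theta> j \<le> dual_part \<epsilon> y j s + ?D - ?P"
    using max unfolding gap_def dual_obj_def sum_split[of "\<lambda>i. dual_part \<epsilon> y i (\<theta>hat $ i)"]
    by (simp add: s_def)
  have part: "dual_part \<epsilon> y j s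
      = (\<epsilon> - y $ j) * exp (- s) + y $ j - \<epsilon> - \<epsilon> * (exp (- s) - 1 + s)"
    by (simp add: dual_part_def algebra_simps)
  have tangent: "0 \<le> exp (- s) - 1 + s" using exp_ge_add_one_self[of "- s"] by simp
  show ?thesis
  proof (cases "y $ j * exp (- s) = \<epsilon>")
    case True
    have "0 < \<epsilon>" using True y j by (metis exp_gt_zero mult_pos_pos)
    have "s \<noteq> 0" using True less by auto
    then have "0 < exp (- s) - 1 + s"
      using exp_minus_greater[of s] by simp
    with \<open>0 < \<epsilon>\<close> have "0 < \<epsilon> * (exp (- s) - 1 + s)" by simp
    then show ?thesis using gap_le weak(1) part by (simp add: s_def)
  next
    case False
    \<comment> \<open>Equality would fix every marginal except the one at \<open>j\<close>, and both the plan and the optimum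
      are balanced, so the term of \<open>j\<close> would have to vanish.\<close>
    have "?D \<noteq> ?P"
    proof
      assume eq: "?D = ?P"
      have "(\<Sum>i\<in>?I. side m i * (y $ i * exp (- (\<theta>hat $ i)) - \<epsilon>))
          = (\<Sum>i\<in>?I. side m i * marginal_del m n j t i)"
        by (intro sum.cong) (auto simp: weak(2)[OF eq, symmetric])
      also have "\<dots> = 0"
        unfolding sum_marginal_del[OF j]
        by (intro sum.neutral) (auto simp: kept_vars_def side_row_plus_col)
      finally have "side m j * (y $ j * exp (- s) - \<epsilon>) = 0"
        using dual_optimal_balanced[OF opt] unfolding sum_split by (simp add: s_def)
      then show False using False by (simp add: side_def split: if_splits)
    qed
    then have "?D < ?P" using weak(1) by simp
    moreover have "0 \<le> \<epsilon> * (exp (- s) - 1 + s)" using \<epsilon> tangent by simp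
    ultimately show ?thesis using gap_le part by (simp add: s_def)
  qed
qed

lemma Low_less:
  assumes "0 \<le> \<epsilon>" "\<forall>i<m + n. y $ i > 0" "\<forall>p<n * m. t $ p \<ge> 0"
    and "dual_optimal m n lam \<epsilon> c y \<theta>hat" "dual_feasible m n lam c \<theta>"
    and "j < m + n" and less: "\<epsilon> < y $ j"
  shows "Low m n lam \<epsilon> c y t \<theta> j < \<theta>hat $ j"
proof -
  let ?d = "gap m n lam \<epsilon> c y t \<theta> j - y $ j + \<epsilon>"
  have d: "?d < (\<epsilon> - y $ j) * exp (- (\<theta>hat $ j))"
    using gap_less[OF assms] by simp
  also have "\<dots> < 0" using less by (simp add: mult_neg_pos)
  finally have "?d < 0" .
  then have pos: "0 < (\<epsilon> - y $ j) / ?d" using less by (simp add: divide_neg_neg)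
  have "?d * exp (\<theta>hat $ j) < \<epsilon> - y $ j"
    using d by (simp add: exp_minus field_simps)
  then have "(\<epsilon> - y $ j) / ?d < exp (\<theta>hat $ j)"
    using \<open>?d < 0\<close> by (simp add: neg_divide_less_eq mult.commute)
  then show ?thesis
    unfolding Low_def using pos by (metis exp_ln exp_less_cancel_iff)
qed

theorem theorem9:
  fixes m n :: nat and lam \<epsilon> :: real and c y t \<theta> \<theta>hat \<alpha> \<beta> :: "real vec"
  assumes "m \<ge> 1" and "n \<ge> 1" and "lam > 0" and "\<epsilon> \<ge> 0"
    and "c \<in> carrier_vec (n * m)" and "\<forall>p<n * m. c $ p \<ge> 0"
    and "y \<in> carrier_vec (m + n)" and "\<forall>i<m + n. y $ i > 0"
    and "dual_optimal m n lam \<epsilon> c y \<theta>hat"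
    and "\<alpha> \<in> carrier_vec m" and "\<beta> \<in> carrier_vec n" and "\<theta>hat = \<alpha> @\<^sub>v \<beta>"
    and "dual_feasible m n lam c \<theta>"
    and "t \<in> carrier_vec (n * m)" and "\<forall>p<n * m. t $ p \<ge> 0"
  shows "(\<forall>j<m + n. \<epsilon> < y $ j \<longrightarrow> Low m n lam \<epsilon> c y t \<theta> j \<le> \<theta>hat $ j) \<and>
    ((\<forall>v<n. \<epsilon> < y $ (m + v)) \<longrightarrow>
      (\<forall>u<m. \<exists>ub. \<alpha> $ u < ub \<and>
        ub < Min ((\<lambda>v. lam * c $ (u * n + v) - Low m n lam \<epsilon> c y t \<theta> (m + v)) ` {..<n}))) \<and>
    ((\<forall>u<m. \<epsilon> < y $ u) \<longrightarrow>
      (\<forall>v<n. \<exists>ub. \<beta> $ v < ub \<and>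
        ub < Min ((\<lambda>u. lam * c $ (u * n + v) - Low m n lam \<epsilon> c y t \<theta> u) ` {..<m})))"
proof -
  have low: "Low m n lam \<epsilon> c y t \<theta> j < \<theta>hat $ j" if "j < m + n" "\<epsilon> < y $ j" for j
    using Low_less assms that by blast
  have \<alpha>: "\<theta>hat $ u = \<alpha> $ u" if "u < m" for u
    using that assms by simp
  have \<beta>: "\<theta>hat $ (m + v) = \<beta> $ v" if "v < n" for v
    using that assms by simp
  have constr: "\<alpha> $ u + \<beta> $ v \<le> lam * c $ (u * n + v)" if "u < m" "v < n" for u v
  proof -
    have "u * n + v < Suc u * n" using that by simp
    also have "\<dots> \<le> n * m" using that by (metis Suc_leI mult.commute mult_le_mono1)
    finally show ?thesis
      using assms that \<alpha>[of u] \<beta>[of v] unfolding dual_optimal_def is_arg_max_def dual_feasible_iff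
      by force
  qed
  have rows: "\<exists>ub. \<alpha> $ u < ub \<and>
      ub < Min ((\<lambda>v. lam * c $ (u * n + v) - Low m n lam \<epsilon> c y t \<theta> (m + v)) ` {..<n})"
    if "\<forall>v<n. \<epsilon> < y $ (m + v)" "u < m" for u
  proof (rule dense, subst Min_gr_iff)
    show "\<forall>a\<in>(\<lambda>v. lam * c $ (u * n + v) - Low m n lam \<epsilon> c y t \<theta> (m + v)) ` {..<n}. \<alpha> $ u < a"
    proof clarify
      fix v assume v: "v < n"
      then have "Low m n lam \<epsilon> c y t \<theta> (m + v) < \<beta> $ v"
        using low[of "m + v"] \<beta> that(1) by simp
      with constr[OF that(2) v]
      show "\<alpha> $ u < lam * c $ (u * n + v) - Low m n lam \<epsilon> c y t \<theta> (m + v)" by linarith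
    qed
  qed (use \<open>n \<ge> 1\<close> in \<open>auto simp: lessThan_empty_iff\<close>)
  have cols: "\<exists>ub. \<beta> $ v < ub \<and>
      ub < Min ((\<lambda>u. lam * c $ (u * n + v) - Low m n lam \<epsilon> c y t \<theta> u) ` {..<m})"
    if "\<forall>u<m. \<epsilon> < y $ u" "v < n" for v
  proof (rule dense, subst Min_gr_iff)
    show "\<forall>a\<in>(\<lambda>u. lam * c $ (u * n + v) - Low m n lam \<epsilon> c y t \<theta> u) ` {..<m}. \<beta> $ v < a"
    proof clarify
      fix u assume u: "u < m"
      then have "Low m n lam \<epsilon> c y t \<theta> u < \<alpha> $ u"
        using low[of u] \<alpha> that(1) by simp
      with constr[OF u that(2)]
      show "\<beta> $ v < lam * c $ (u * n + v) - Low m n lam \<epsilon> c y t \<theta> u" by linarith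
    qed
  qed (use \<open>m \<ge> 1\<close> in \<open>auto simp: lessThan_empty_iff\<close>)
  show ?thesis using low rows cols by (simp add: less_imp_le)
qed

end
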